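(* Let $f:\mathbb{R}^n\to\mathbb{R}^n$ be continuously differentiable with Jacobian $J(x)=\frac{\partial f}{\partial x}(x)$. Let $|\cdot|$ be a vector norm on $\mathbb{R}^n$ and let $\mu$ be the matrix measure associated with $|\cdot|$. If there exists $c>0$ such that $\mu(J(x))\le -c$ for all $x\in\mathbb{R}^n$, then every solution $x(\cdot)$ of the autonomous system $\dot x=f(x)$, defined on an interval $[0,T)$ with $0<T\le\infty$, satisfies $$|f(x(t))|\le |f(x(0))|\,e^{-ct}\quad\text{for all } t\in[0,T).$$
   Context: For a vector norm $|\cdot|$ on $\mathbb{R}^n$, let $\Vert\cdot\Vert$ denote the induced matrix norm on $\mathbb{R}^{n\times n}$, $\Vert A\Vert=\sup_{|v|=1}|Av|$. The associated matrix measure (logarithmic norm) of $A\in\mathbb{R}^{n\times n}$ is $$\mu(A)=\lim_{h\to 0^+}\frac{1}{h}\left(\Vert I+hA\Vert-1\right),$$ where $I$ is the identity matrix. The norm $|\cdot|$ is arbitrary (not necessarily Euclidean). *)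

theory Defs
  imports "HOL-Analysis.Analysis"
begin

definition vector_norm :: "(real^'n \<Rightarrow> real) \<Rightarrow> bool" where
  "vector_norm N \<longleftrightarrow>
     (\<forall>v. 0 \<le> N v) \<and>
     (\<forall>v. N v = 0 \<longleftrightarrow> v = 0) \<and>
     (\<forall>a v. N (a *\<^sub>R v) = \<bar>a\<bar> * N v) \<and>
     (\<forall>v w. N (v + w) \<le> N v + N w)"

(* For a vector norm N the supremum is over a nonempty set bounded above: an index type is never
   empty, and all norms on real^'n are equivalent. *)
definition induced_norm :: "(real^'n \<Rightarrow> real) \<Rightarrow> real^'n^'n \<Rightarrow> real" where
  "induced_norm N A = (SUP v\<in>{v. N v = 1}. N (A *v v))"

(* For a vector norm N the limit exists for every A, so Lim is never an arbitrary value: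
   the quotient is nondecreasing in h by convexity, and bounded below by - induced_norm N A. *)
definition matrix_measure :: "(real^'n \<Rightarrow> real) \<Rightarrow> real^'n^'n \<Rightarrow> real" where
  "matrix_measure N A =
     Lim (at_right 0) (\<lambda>h. (1 / h) * (induced_norm N (mat 1 + h *\<^sub>R A) - 1))"

end

theory Submission
  imports Defs
begin

text \<open>
  Along a solution \<open>x\<close> the vector \<open>w = f \<circ> x\<close> satisfies the linear variational equation
  \<open>w' = J(x) w\<close>, so the rescaled vector \<open>v(t) = exp (c t) w(t)\<close> satisfies \<open>v' = (J(x) + c I) v\<close>.
  Because the matrix measure of \<open>J(x)\<close> is at most \<open>- c\<close>, the upper right Dini derivative of
  the norm of \<open>v\<close> is nonpositive, and a continuous function with this property is nonincreasing.
\<close>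

section \<open>A monotonicity criterion by Dini derivatives\<close>

text \<open>Fix a slope \<open>e > 0\<close>. The points where \<open>g\<close> stays below the line
  of slope \<open>e\<close> starting at \<open>(a, g a)\<close> form a closed set, and
  \<open>dini\<close> lets that set be continued to the right of any of its points before
  \<open>b\<close>. So it reaches \<open>b\<close>, and \<open>e\<close> can then be made
  small.\<close>

lemma Dini_nonpos_imp_le:
  fixes g :: "real \<Rightarrow> real"
  assumes ab: "a \<le> b" and cont: "continuous_on {a..b} g"
    and dini: "\<And>s e. a \<le> s \<Longrightarrow> s < b \<Longrightarrow> 0 < e \<Longrightarrow>
                 eventually (\<lambda>u. g u \<le> g s + e * (u - s)) (at_right s)"
  shows "g b \<le> g a"
proof (rule field_le_epsilon)
  fix d :: real assume d: "0 < d"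
  \<comment> \<open>The \<open>+ 1\<close> keeps the denominator positive when \<open>a = b\<close>;
    the total rise of the line over \<open>{a..b}\<close> is at most \<open>d\<close>.\<close>
  define e where "e = d / (b - a + 1)"
  have e: "0 < e" "e * (b - a) \<le> d"
    using d ab by (auto simp: e_def field_simps)
  define A where "A = {u \<in> {a..b}. g u \<le> g a + e * (u - a)}"
  have "closed A"
    unfolding A_def
    by (intro continuous_on_closed_Collect_le cont continuous_intros closed_atLeastAtMost)
  have bdd: "bdd_above A"
    by (auto simp: A_def intro!: bdd_aboveI[of _ b])
  have ne: "A \<noteq> {}"
    using ab by (auto simp: A_def intro!: exI[of _ a])
  define m where "m = Sup A"
  \<comment> \<open>Closedness matters here: the bound holds at the supremum itself, so
    \<open>dini\<close> can be restarted from \<open>m\<close>.\<close>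
  have mA: "m \<in> A"
    unfolding m_def by (rule closed_contains_Sup[OF ne bdd \<open>closed A\<close>])
  have "m = b"
  proof (rule ccontr)
    assume "m \<noteq> b"
    then have m: "a \<le> m" "m < b" "g m \<le> g a + e * (m - a)"
      using mA by (auto simp: A_def)
    have "eventually (\<lambda>u. u \<in> {m<..<b}) (at_right m)"
      using m(2) by (rule eventually_at_right_real)
    with dini[OF m(1,2) e(1)]
    have "eventually (\<lambda>u. g u \<le> g m + e * (u - m) \<and> u \<in> {m<..<b}) (at_right m)"
      by (rule eventually_conj)
    then obtain u where u: "g u \<le> g m + e * (u - m)" "m < u" "u < b"
      using eventually_happens trivial_limit_at_right_real by fastforce
    \<comment> \<open>The bound at \<open>m\<close> and the bound from \<open>m\<close> to
      \<open>u\<close> have the same slope \<open>e\<close>, so they add up to the bound at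
      \<open>u\<close>, beyond the supremum.\<close>
    have "u \<in> A"
      using u m by (auto simp: A_def algebra_simps)
    then have "u \<le> m"
      unfolding m_def by (rule cSup_upper[OF _ bdd])
    with u(2) show False by simp
  qed
  then have "g b \<le> g a + e * (b - a)"
    using mA by (auto simp: A_def)
  then show "g b \<le> g a + d"
    using e(2) by simp
qed

section \<open>Vector norms and their equivalence with the Euclidean norm\<close>

context
  fixes N :: "real^'n \<Rightarrow> real"
  assumes N: "vector_norm N"
begin

lemma vector_norm_nonneg: "0 \<le> N v"
  and vector_norm_eq_0_iff: "N v = 0 \<longleftrightarrow> v = 0"
  and vector_norm_scaleR: "N (a *\<^sub>R v) = \<bar>a\<bar> * N v"
  and vector_norm_triangle: "N (v + w) \<le> N v + N w"
  using N unfolding vector_norm_def by blast+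

lemma vector_norm_sum: "finite S \<Longrightarrow> N (\<Sum>i\<in>S. h i) \<le> (\<Sum>i\<in>S. N (h i))"
proof (induction S rule: finite_induct)
  case empty
  then show ?case using vector_norm_eq_0_iff[of 0] by simp
next
  case (insert i S)
  then show ?case using vector_norm_triangle[of "h i" "sum h S"] by simp
qed

text \<open>Expand \<open>v\<close> in the standard basis: every coordinate is at most
  \<open>norm v\<close> in absolute value.\<close>

lemma vector_norm_le_norm: "\<exists>B>0. \<forall>v. N v \<le> B * norm v"
proof (intro exI conjI allI)
  let ?B = "\<Sum>i\<in>(Basis::(real^'n) set). N i"
  show "0 < ?B + 1"
    using sum_nonneg[of Basis N] vector_norm_nonneg by (simp add: add_nonneg_pos)
  show "N v \<le> (?B + 1) * norm v" for v
  proof -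
    have "N v = N (\<Sum>i\<in>Basis. (v \<bullet> i) *\<^sub>R i)"
      by (simp add: euclidean_representation)
    also have "\<dots> \<le> (\<Sum>i\<in>Basis. N ((v \<bullet> i) *\<^sub>R i))"
      by (rule vector_norm_sum) simp
    also have "\<dots> \<le> (\<Sum>i\<in>Basis. norm v * N i)"
      by (intro sum_mono) (simp add: vector_norm_scaleR mult_right_mono vector_norm_nonneg Basis_le_norm)
    also have "\<dots> \<le> (?B + 1) * norm v"
      by (simp add: sum_distrib_left algebra_simps)
    finally show ?thesis .
  qed
qed

text \<open>By the triangle inequality, the upper bound by the Euclidean norm is also a Lipschitz
  constant.\<close>

lemma vector_norm_continuous: "continuous_on S N"
proof -
  obtain B where B: "0 < B" "\<And>v. N v \<le> B * norm v"
    using vector_norm_le_norm by blast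
  have le: "N v - N w \<le> B * dist v w" for v w
    using vector_norm_triangle[of "v - w" w] B(2)[of "v - w"] by (simp add: dist_norm)
  have "B-lipschitz_on S N"
  proof (rule lipschitz_onI)
    show "dist (N v) (N w) \<le> B * dist v w" for v w
      using le[of v w] le[of w v] by (simp add: dist_real_def abs_le_iff dist_commute)
  qed (use B(1) in simp)
  then show ?thesis
    by (rule lipschitz_on_continuous_on)
qed

text \<open>\<open>N\<close> attains its minimum on the compact Euclidean unit sphere. It is
  positive since the sphere misses 0, and homogeneity carries it to all vectors.\<close>

lemma norm_le_vector_norm: "\<exists>b>0. \<forall>v. b * norm v \<le> N v"
proof -
  obtain u where u: "u \<in> sphere 0 1" "\<forall>v\<in>sphere 0 1. N u \<le> N v"
    using continuous_attains_inf[of "sphere 0 1" N] vector_norm_continuous by auto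
  show ?thesis
  proof (intro exI conjI allI)
    show "0 < N u"
      using u(1) vector_norm_nonneg[of u] vector_norm_eq_0_iff[of u] by force
    show "N u * norm v \<le> N v" for v
    proof (cases "v = 0")
      case True
      then show ?thesis using vector_norm_nonneg by simp
    next
      case False
      then have "N u \<le> N ((1 / norm v) *\<^sub>R v)"
        using u(2) by (auto simp: sphere_def)
      then show ?thesis
        using False by (simp add: vector_norm_scaleR field_simps)
    qed
  qed
qed

section \<open>The induced matrix norm\<close>

text \<open>Together with \<open>unit_vector_exists\<close> this makes the real supremum in
  \<open>induced_norm\<close> a genuine one. The unit sphere of \<open>N\<close> is Euclidean
  bounded, \<open>A\<close> is a bounded operator, and \<open>N\<close> is dominated by the
  Euclidean norm.\<close>

lemma induced_norm_bdd_above: "bdd_above ((\<lambda>v. N (A *v v)) ` {v. N v = 1})"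
proof -
  obtain B where B: "0 < B" "\<And>v. N v \<le> B * norm v"
    using vector_norm_le_norm by blast
  obtain b where b: "0 < b" "\<And>v. b * norm v \<le> N v"
    using norm_le_vector_norm by blast
  obtain K where K: "0 < K" "\<And>v. norm (A *v v) \<le> norm v * K"
    using bounded_linear.pos_bounded[OF matrix_vector_mul_bounded_linear[of A]] by blast
  have "N (A *v v) \<le> B * (1 / b * K)" if "N v = 1" for v
  proof -
    have "norm v \<le> 1 / b"
      using b(2)[of v] b(1) that by (simp add: field_simps)
    then have "norm v * K \<le> 1 / b * K"
      using K(1) by (intro mult_right_mono) auto
    then have "norm (A *v v) \<le> 1 / b * K"
      using K(2)[of v] by linarith
    then have "B * norm (A *v v) \<le> B * (1 / b * K)"
      using B(1) by (intro mult_left_mono) auto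
    then show ?thesis
      using B(2)[of "A *v v"] by linarith
  qed
  then show ?thesis
    by (intro bdd_aboveI2) auto
qed

lemma vector_norm_matrix_vector_le: "N (A *v v) \<le> induced_norm N A * N v"
proof (cases "v = 0")
  case True
  then show ?thesis using vector_norm_eq_0_iff[of 0] by simp
next
  case False
  then have pos: "0 < N v"
    using vector_norm_nonneg[of v] vector_norm_eq_0_iff[of v] by linarith
  have "N (A *v ((1 / N v) *\<^sub>R v)) \<le> induced_norm N A"
    unfolding induced_norm_def
    using pos by (intro cSUP_upper induced_norm_bdd_above) (simp add: vector_norm_scaleR)
  then show ?thesis
    using pos by (simp add: matrix_vector_mult_scaleR vector_norm_scaleR field_simps)
qed

lemma unit_vector_exists: "\<exists>v. N v = 1"
proof -
  obtain i :: "real^'n" where "i \<in> Basis" using nonempty_Basis by blast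
  then have "N i \<noteq> 0" using vector_norm_eq_0_iff[of i] by auto
  then have "N ((1 / N i) *\<^sub>R i) = 1"
    using vector_norm_nonneg[of i] by (simp add: vector_norm_scaleR)
  then show ?thesis ..
qed

lemma induced_norm_le:
  assumes "\<And>v. N v = 1 \<Longrightarrow> N (A *v v) \<le> K"
  shows "induced_norm N A \<le> K"
  unfolding induced_norm_def using unit_vector_exists assms by (intro cSUP_least) auto

lemma induced_norm_triangle: "induced_norm N (A + B) \<le> induced_norm N A + induced_norm N B"
proof (rule induced_norm_le)
  fix v assume "N v = 1"
  then show "N ((A + B) *v v) \<le> induced_norm N A + induced_norm N B"
    using vector_norm_triangle[of "A *v v" "B *v v"]
      vector_norm_matrix_vector_le[of A v] vector_norm_matrix_vector_le[of B v]
    by (simp add: matrix_vector_mult_add_rdistrib)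
qed

lemma induced_norm_scaleR_le:
  assumes "0 \<le> a" shows "induced_norm N (a *\<^sub>R A) \<le> a * induced_norm N A"
proof (rule induced_norm_le)
  fix v assume "N v = 1"
  then show "N ((a *\<^sub>R A) *v v) \<le> a * induced_norm N A"
    using vector_norm_matrix_vector_le[of A v] assms
    by (simp add: scaleR_matrix_vector_assoc[symmetric] vector_norm_scaleR mult_left_mono)
qed

lemma induced_norm_mat_1: "induced_norm N (mat 1) = 1"
proof (rule antisym)
  show "induced_norm N (mat 1) \<le> 1"
    by (rule induced_norm_le) simp
  obtain v where "N v = 1" using unit_vector_exists ..
  then show "1 \<le> induced_norm N (mat 1)"
    using vector_norm_matrix_vector_le[of "mat 1" v] by simp
qed

section \<open>Existence of the matrix measure as a limit\<close>

text \<open>The quotient is the slope, from 0 to \<open>h\<close>, of a convex function of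
  \<open>h\<close>. It does not increase as \<open>h\<close> shrinks and is bounded below, so it
  tends to its infimum over \<open>h > 0\<close>.\<close>

lemma matrix_measure_tendsto:
  "((\<lambda>h. (1 / h) * (induced_norm N (mat 1 + h *\<^sub>R A) - 1)) \<longlongrightarrow> matrix_measure N A) (at_right 0)"
proof -
  let ?q = "\<lambda>h. (1 / h) * (induced_norm N (mat 1 + h *\<^sub>R A) - 1)"
  have lower: "- induced_norm N (- A) \<le> ?q h" if "0 < h" for h
  proof -
    have "1 = induced_norm N ((mat 1 + h *\<^sub>R A) + h *\<^sub>R (- A))"
      by (simp add: induced_norm_mat_1)
    also have "\<dots> \<le> induced_norm N (mat 1 + h *\<^sub>R A) + h * induced_norm N (- A)"
      using induced_norm_triangle[of "mat 1 + h *\<^sub>R A" "h *\<^sub>R (- A)"]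
        induced_norm_scaleR_le[of h "- A"] that by linarith
    finally show ?thesis
      using that by (simp add: field_simps)
  qed
  have mono: "?q h \<le> ?q k" if "0 < h" "h \<le> k" for h k
  proof -
    let ?r = "h / k"
    have r: "0 \<le> ?r" "0 \<le> 1 - ?r" using that by auto
    \<comment> \<open>Convexity: this matrix lies on the segment from \<open>mat 1\<close> to the
      one with parameter \<open>k\<close>, at ratio \<open>h / k\<close>.\<close>
    have "mat 1 + h *\<^sub>R A = ?r *\<^sub>R (mat 1 + k *\<^sub>R A) + (1 - ?r) *\<^sub>R mat 1"
      using that by (simp add: algebra_simps)
    then have "induced_norm N (mat 1 + h *\<^sub>R A)
        \<le> ?r * induced_norm N (mat 1 + k *\<^sub>R A) + (1 - ?r)"
      using induced_norm_triangle[of "?r *\<^sub>R (mat 1 + k *\<^sub>R A)" "(1 - ?r) *\<^sub>R mat 1"]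
        induced_norm_scaleR_le[OF r(1), of "mat 1 + k *\<^sub>R A"]
        induced_norm_scaleR_le[OF r(2), of "mat 1"]
      by (simp add: induced_norm_mat_1)
    then have "induced_norm N (mat 1 + h *\<^sub>R A) - 1
        \<le> h * ((1 / k) * (induced_norm N (mat 1 + k *\<^sub>R A) - 1))"
      using that by (simp add: right_diff_distrib)
    then show ?thesis
      using that(1) by (simp add: pos_divide_le_eq mult.commute)
  qed
  let ?l = "INF h\<in>{0<..}. ?q h"
  have bdd: "bdd_below (?q ` {0<..})"
    using lower by (intro bdd_belowI2) auto
  have "(?q \<longlongrightarrow> ?l) (at_right 0)"
  proof (rule decreasing_tendsto)
    show "eventually (\<lambda>h. ?l \<le> ?q h) (at_right 0)"
      using eventually_at_right_less[of "0::real"]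
      by eventually_elim (rule cINF_lower[OF bdd], simp)
    fix y assume "?l < y"
    then obtain k where k: "0 < k" "?q k < y"
      using cINF_less_iff[OF _ bdd, of y] by auto
    have "eventually (\<lambda>h. h \<in> {0<..<k}) (at_right 0)"
      using k(1) by (rule eventually_at_right_real)
    then show "eventually (\<lambda>h. ?q h < y) (at_right 0)"
    proof eventually_elim
      case (elim h)
      then show ?case using mono[of h k] k(2) by simp
    qed
  qed
  moreover from this have "matrix_measure N A = ?l"
    unfolding matrix_measure_def by (intro tendsto_Lim) auto
  ultimately show ?thesis by simp
qed

section \<open>Growth of the norm under a linear equation\<close>

text \<open>Adding c times the identity raises the matrix measure by \<open>c\<close>, here to at
  most 0. This shift is carried out by hand, writing I + h (A + c I) as (1 + h c) (I + k A), so that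
  the limit for \<open>A\<close> alone suffices.\<close>

lemma matrix_measure_Euler_step:
  assumes mu: "matrix_measure N A \<le> - c" and c: "0 < c" and e: "0 < e"
  shows "eventually (\<lambda>h. N (v + h *\<^sub>R (A *v v + c *\<^sub>R v)) \<le> N v + h * (e * N v)) (at_right 0)"
proof -
  have "eventually (\<lambda>h. (1 / h) * (induced_norm N (mat 1 + h *\<^sub>R A) - 1) < - c + e) (at_right 0)"
    using mu e by (intro order_tendstoD(2)[OF matrix_measure_tendsto]) simp
  then obtain d where d: "0 < d" and
    dh: "\<And>k. 0 < k \<Longrightarrow> k < d \<Longrightarrow> (1 / k) * (induced_norm N (mat 1 + k *\<^sub>R A) - 1) < - c + e"
    unfolding eventually_at_right_field by auto
  have "eventually (\<lambda>h. h \<in> {0<..<d}) (at_right 0)"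
    using d by (rule eventually_at_right_real)
  then show ?thesis
  proof eventually_elim
    case (elim h)
    \<comment> \<open>Chosen so that \<open>(1 + h * c) * k = h\<close>; since
      \<open>k \<le> h\<close>, the bound valid below \<open>d\<close> applies to
      \<open>k\<close>.\<close>
    define k where "k = h / (1 + h * c)"
    have pos: "0 < 1 + h * c"
      using elim c by (simp add: add_pos_pos)
    have k: "0 < k" "k \<le> h" "(1 + h * c) * k = h"
      using elim c pos by (simp_all add: k_def pos_divide_le_eq)
    have "induced_norm N (mat 1 + k *\<^sub>R A) - 1 < (- c + e) * k"
      using dh[of k] k elim by (simp add: pos_divide_less_eq)
    then have step: "induced_norm N (mat 1 + k *\<^sub>R A) \<le> 1 + k * (e - c)"
      by (simp add: algebra_simps)
    have "v + h *\<^sub>R (A *v v + c *\<^sub>R v) = (1 + h * c) *\<^sub>R ((mat 1 + k *\<^sub>R A) *v v)"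
      using k(3)
      by (simp add: matrix_vector_mult_add_rdistrib scaleR_matrix_vector_assoc[symmetric]
          scaleR_add_right scaleR_add_left)
    then have "N (v + h *\<^sub>R (A *v v + c *\<^sub>R v)) = (1 + h * c) * N ((mat 1 + k *\<^sub>R A) *v v)"
      using pos by (simp add: vector_norm_scaleR)
    also have "\<dots> \<le> (1 + h * c) * ((1 + k * (e - c)) * N v)"
      using pos vector_norm_matrix_vector_le[of "mat 1 + k *\<^sub>R A" v]
        mult_right_mono[OF step vector_norm_nonneg[of v]]
      by (intro mult_left_mono) auto
    also have "\<dots> = ((1 + h * c) + ((1 + h * c) * k) * (e - c)) * N v"
      by (simp add: algebra_simps)
    \<comment> \<open>The growth \<open>h * c\<close> from the shift cancels against the decay; only
      the slack \<open>e\<close> survives.\<close>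
    also have "\<dots> = N v + h * (e * N v)"
      unfolding k(3) by (simp add: algebra_simps)
    finally show ?case .
  qed
qed

text \<open>To first order \<open>v\<close> follows one Euler step with \<open>A\<close> frozen at
  time \<open>s\<close>. The step and the remainder each use half of the slack
  \<open>e\<close>.\<close>

lemma vector_norm_Dini_nonpos:
  assumes mu: "matrix_measure N A \<le> - c" and c: "0 < c" and e: "0 < e"
    and der: "(v has_vector_derivative (A *v v s + c *\<^sub>R v s)) (at_right s)"
  shows "eventually (\<lambda>u. N (v u) \<le> N (v s) + e * (u - s)) (at_right s)"
proof -
  let ?q = "A *v v s + c *\<^sub>R v s"
  \<comment> \<open>The remainder quotient from the definition of the derivative, which tends to 0;
    for \<open>u > s\<close> its denominator is \<open>u - s\<close>.\<close>
  let ?r = "\<lambda>u. (1 / norm (u - s)) *\<^sub>R (v u - (v s + (u - s) *\<^sub>R ?q))"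
  \<comment> \<open>The Euler step grows in proportion to \<open>N (v s)\<close>, so the slack is
    divided by it; the \<open>+ 1\<close> covers \<open>N (v s) = 0\<close>.\<close>
  define e' where "e' = e / (2 * (N (v s) + 1))"
  have nn: "0 < N (v s) + 1" using vector_norm_nonneg[of "v s"] by simp
  have e': "0 < e'" "e' * N (v s) \<le> e / 2"
    using e nn by (auto simp: e'_def field_simps)
  have "isCont N 0"
    using vector_norm_continuous[of UNIV] by (simp add: continuous_on_eq_continuous_at)
  moreover have "(?r \<longlongrightarrow> 0) (at_right s)"
    using der unfolding has_vector_derivative_def has_derivative_within by (rule conjunct2)
  ultimately have "((\<lambda>u. N (?r u)) \<longlongrightarrow> N 0) (at_right s)"
    by (rule isCont_tendsto_compose)
  then have r: "eventually (\<lambda>u. N (?r u) < e / 2) (at_right s)"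
    using e vector_norm_eq_0_iff[of 0] by (intro order_tendstoD(2)) auto
  have step: "eventually (\<lambda>u. N (v s + (u - s) *\<^sub>R ?q) \<le> N (v s) + (u - s) * (e' * N (v s))) (at_right s)"
    using matrix_measure_Euler_step[OF mu c e'(1), of "v s"]
    by (subst eventually_at_right_to_0) simp
  from r step eventually_at_right_less[of s] show ?thesis
  proof eventually_elim
    case (elim u)
    have "v u = (v s + (u - s) *\<^sub>R ?q) + (u - s) *\<^sub>R ?r u"
      using elim(3) by simp
    then have "N (v u) \<le> N (v s + (u - s) *\<^sub>R ?q) + (u - s) * N (?r u)"
      using vector_norm_triangle[of "v s + (u - s) *\<^sub>R ?q" "(u - s) *\<^sub>R ?r u"] elim(3)
      by (simp add: vector_norm_scaleR)
    also have "\<dots> \<le> (N (v s) + (u - s) * (e / 2)) + (u - s) * (e / 2)"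
      using elim mult_left_mono[OF e'(2), of "u - s"] mult_left_mono[of "N (?r u)" "e / 2" "u - s"]
      by linarith
    also have "\<dots> = N (v s) + e * (u - s)"
      by (simp add: algebra_simps)
    finally show ?case .
  qed
qed

end

section \<open>Exponential decay of the vector field along a solution\<close>

theorem theorem1:
  fixes f :: "real^'n \<Rightarrow> real^'n"
    and N :: "real^'n \<Rightarrow> real"
    and c :: real
    and T :: ereal
    and x :: "real \<Rightarrow> real^'n"
  assumes "\<And>y. f differentiable (at y)"
    and "continuous_on UNIV (\<lambda>y. jacobian f (at y))"
    and "vector_norm N"
    and "c > 0"
    and "\<And>y. matrix_measure N (jacobian f (at y)) \<le> - c"
    and "0 < T"
    and "\<And>t. 0 \<le> t \<Longrightarrow> ereal t < T \<Longrightarrow>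
           (x has_vector_derivative f (x t)) (at t within {s. 0 \<le> s \<and> ereal s < T})"
  shows "\<forall>t. 0 \<le> t \<and> ereal t < T \<longrightarrow> N (f (x t)) \<le> N (f (x 0)) * exp (- c * t)"
proof (intro allI impI, elim conjE)
  fix t :: real assume t: "0 \<le> t" "ereal t < T"
  let ?J = "\<lambda>s. jacobian f (at (x s))"
  define v where "v s = exp (c * s) *\<^sub>R f (x s)" for s
  have der: "(v has_vector_derivative (?J s *v v s + c *\<^sub>R v s)) (at s within {0..t})"
    if s: "s \<in> {0..t}" for s
  proof -
    \<comment> \<open>The compact interval \<open>{0..t}\<close> lies in the domain of the solution,
      whether \<open>T\<close> is finite or infinite.\<close>
    have "ereal u < T" if "u \<le> t" for u
      using that t(2) by (meson ereal_less_eq(3) le_less_trans)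
    then have "(x has_vector_derivative f (x s)) (at s within {0..t})"
      using s by (intro has_vector_derivative_within_subset[OF assms(7)]) auto
    moreover have "(f has_derivative (\<lambda>h. ?J s *v h)) (at (x s) within x ` {0..t})"
      using assms(1)[of "x s"] jacobian_works has_derivative_at_withinI by blast
    \<comment> \<open>The velocity of \<open>x\<close> is \<open>f (x s)\<close> itself, so the
      chain rule applies the Jacobian to the very vector being differentiated.\<close>
    ultimately have w: "((\<lambda>s. f (x s)) has_vector_derivative ?J s *v f (x s)) (at s within {0..t})"
      using vector_derivative_diff_chain_within[of x "f (x s)" s "{0..t}" f "\<lambda>h. ?J s *v h"]
      by (simp add: o_def)
    have "((\<lambda>s. exp (c * s)) has_real_derivative exp (c * s) * c) (at s within {0..t})"
      by (auto intro!: derivative_eq_intros)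
    from has_vector_derivative_scaleR[OF this w] show ?thesis
      by (simp add: v_def[abs_def] matrix_vector_mult_scaleR algebra_simps)
  qed
  have "continuous_on {0..t} v"
    using der by (meson continuous_on_eq_continuous_within has_vector_derivative_continuous)
  then have "continuous_on {0..t} (\<lambda>s. N (v s))"
    by (rule continuous_on_compose2[OF vector_norm_continuous[OF assms(3), of UNIV]]) simp
  then have "N (v t) \<le> N (v 0)"
  proof (rule Dini_nonpos_imp_le[OF t(1)])
    fix s e :: real assume s: "0 \<le> s" "s < t" and e: "0 < e"
    have "(v has_vector_derivative (?J s *v v s + c *\<^sub>R v s)) (at s within {s..t})"
      using s by (intro has_vector_derivative_within_subset[OF der]) auto
    \<comment> \<open>As \<open>s < t\<close>, differentiability within \<open>{s..t}\<close> is
      right differentiability at \<open>s\<close>.\<close>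
    then have "(v has_vector_derivative (?J s *v v s + c *\<^sub>R v s)) (at_right s)"
      using s by (simp add: at_within_Icc_at_right)
    then show "eventually (\<lambda>u. N (v u) \<le> N (v s) + e * (u - s)) (at_right s)"
      by (rule vector_norm_Dini_nonpos[OF assms(3) assms(5) assms(4) e])
  qed
  then have "exp (c * t) * N (f (x t)) \<le> N (f (x 0))"
    by (simp add: v_def vector_norm_scaleR[OF assms(3)])
  then show "N (f (x t)) \<le> N (f (x 0)) * exp (- c * t)"
    by (simp add: exp_minus field_simps)
qed

end
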